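(* Let $k\ge1$. The set of ind-minimal ages of binary structures of type $k$ having nonempty kernel is at most countable.
   Context: A binary structure of type $k$ is $\mathcal{R}=(E,\rho_1,\dots,\rho_k)$ with binary relations on $E$; its age is the class of its finite restrictions up to isomorphism. $\mathrm{Ker}(\mathcal{R})$ is the set of $x\in E$ with $\mathrm{Age}(\mathcal{R}_{\restriction E\setminus\{x\}})\subsetneq\mathrm{Age}(\mathcal{R})$; the kernel of an age $\mathcal{A}$ is the kernel of any structure $\mathcal{R}$ with $\mathrm{Age}(\mathcal{R})=\mathcal{A}$ (its cardinality does not depend on the choice of $\mathcal{R}$). Intervals: $A\subseteq E$ with $x\rho_i a\Leftrightarrow x\rho_i a'$ and $a\rho_i x\Leftrightarrow a'\rho_i x$ for all $i$, $a,a'\in A$, $x\notin A$; indecomposable means only trivial intervals. $\Omega_k$ is the class of finite binary structures of type $k$ up to isomorphism and $\mathrm{Ind}(\Omega_k)$ its indecomposable members. A class $\mathcal{C}\subseteq\Omega_k$ is ind-minimal if $\mathcal{C}\cap\mathrm{Ind}(\Omega_k)$ is infinite and for every proper hereditary subclass $\mathcal{C}'$ of $\mathcal{C}$, $\mathcal{C}'\cap\mathrm{Ind}(\Omega_k)$ is finite. *)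

theory Defs
  imports Complex_Main "HOL-Library.Countable_Set"
begin

text \<open>A binary structure is a base set together with relations indexed by \<open>1, \<dots>, k\<close>.  Relations
  with an index outside this range are required to be empty.\<close>

datatype 'a bstruct = BStruct (base: "'a set") (rel: "nat \<Rightarrow> ('a \<times> 'a) set")

definition is_bstruct :: "nat \<Rightarrow> 'a bstruct \<Rightarrow> bool" where
  "is_bstruct k R \<longleftrightarrow>
     (\<forall>i\<in>{1..k}. rel R i \<subseteq> base R \<times> base R) \<and> (\<forall>i. i \<notin> {1..k} \<longrightarrow> rel R i = {})"

definition restrict_to :: "'a bstruct \<Rightarrow> 'a set \<Rightarrow> 'a bstruct" where
  "restrict_to R A = BStruct (base R \<inter> A) (\<lambda>i. rel R i \<inter> (A \<times> A))"

definition isomorphic :: "nat \<Rightarrow> 'a bstruct \<Rightarrow> 'b bstruct \<Rightarrow> bool" where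
  "isomorphic k R S \<longleftrightarrow>
     (\<exists>f. bij_betw f (base R) (base S) \<and>
          (\<forall>i\<in>{1..k}. \<forall>x\<in>base R. \<forall>y\<in>base R. (x, y) \<in> rel R i \<longleftrightarrow> (f x, f y) \<in> rel S i))"

text \<open>Finite structures are considered up to isomorphism.  The isomorphism type of a finite
  structure over any type is the set of its copies on finite sets of natural numbers, of which
  there is at least one; for finite structures, having the same type is the same as being
  isomorphic.\<close>

definition iso_type :: "nat \<Rightarrow> 'a bstruct \<Rightarrow> nat bstruct set" where
  "iso_type k R = {T. is_bstruct k T \<and> finite (base T) \<and> isomorphic k R T}"

definition Omega :: "nat \<Rightarrow> nat bstruct set set" where
  "Omega k = {iso_type k S | S :: nat bstruct. is_bstruct k S \<and> finite (base S)}"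

definition Age :: "nat \<Rightarrow> 'a bstruct \<Rightarrow> nat bstruct set set" where
  "Age k R = {iso_type k (restrict_to R F) | F. F \<subseteq> base R \<and> finite F}"

definition Ker :: "nat \<Rightarrow> 'a bstruct \<Rightarrow> 'a set" where
  "Ker k R = {x \<in> base R. Age k (restrict_to R (base R - {x})) \<subset> Age k R}"

definition interval :: "nat \<Rightarrow> 'a bstruct \<Rightarrow> 'a set \<Rightarrow> bool" where
  "interval k R A \<longleftrightarrow> A \<subseteq> base R \<and>
     (\<forall>i\<in>{1..k}. \<forall>a\<in>A. \<forall>a'\<in>A. \<forall>x\<in>base R - A.
        ((x, a) \<in> rel R i \<longleftrightarrow> (x, a') \<in> rel R i) \<and> ((a, x) \<in> rel R i \<longleftrightarrow> (a', x) \<in> rel R i))"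

definition indecomposable :: "nat \<Rightarrow> 'a bstruct \<Rightarrow> bool" where
  "indecomposable k R \<longleftrightarrow>
     (\<forall>A. interval k R A \<longrightarrow> A = {} \<or> (\<exists>x\<in>base R. A = {x}) \<or> A = base R)"

definition Ind_Omega :: "nat \<Rightarrow> nat bstruct set set" where
  "Ind_Omega k =
     {iso_type k S | S :: nat bstruct. is_bstruct k S \<and> finite (base S) \<and> indecomposable k S}"

text \<open>A class is hereditary if it contains every structure embeddable in one of its members.  Up to
  isomorphism these are the restrictions of the members.\<close>

definition hereditary :: "nat \<Rightarrow> nat bstruct set set \<Rightarrow> bool" where
  "hereditary k C \<longleftrightarrow> C \<subseteq> Omega k \<and>
     (\<forall>c\<in>C. \<forall>S\<in>c. \<forall>F. F \<subseteq> base S \<longrightarrow> iso_type k (restrict_to S F) \<in> C)"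

definition ind_minimal :: "nat \<Rightarrow> nat bstruct set set \<Rightarrow> bool" where
  "ind_minimal k C \<longleftrightarrow> C \<subseteq> Omega k \<and> infinite (C \<inter> Ind_Omega k) \<and>
     (\<forall>C'. C' \<subset> C \<and> hereditary k C' \<longrightarrow> finite (C' \<inter> Ind_Omega k))"

text \<open>An age has nonempty kernel if it is the age of some structure with nonempty kernel: the
  cardinality of the kernel is the same for all structures with the same age.  The base sets are
  subsets of an arbitrary type \<open>'a\<close>, whereas ages are always sets of isomorphism types on
  natural numbers, so that ages of structures over different types can be compared.\<close>

definition ages_with_nonempty_kernel :: "nat \<Rightarrow> 'a itself \<Rightarrow> nat bstruct set set set" where
  "ages_with_nonempty_kernel k _ = {Age k R | R :: 'a bstruct. is_bstruct k R \<and> Ker k R \<noteq> {}}"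

end

theory Submission
  imports Defs "HOL-Library.Ramsey"
begin

text \<open>Let \<open>x\<close> be in the kernel of \<open>R\<close>, where the age of \<open>R\<close> is ind-minimal.  The age of \<open>R - x\<close> is a
  proper hereditary subclass, so it has only finitely many indecomposable members and their sizes
  are bounded by some \<open>n\<close>.  The finite structures with a distinguished point whose indecomposable
  restrictions avoiding the point have size at most \<open>n\<close> are well-quasi-ordered by embeddings
  preserving the point.  Indeed, apart from the point, such a structure with at least three elements
  is a lexicographic sum of between \<open>2\<close> and \<open>n\<close> smaller structures, so that the parts of a minimal
  bad sequence, which do not admit a bad sequence themselves, can be compared by Ramsey's theorem.
  A well-quasi-order on a countable set has only countably many downsets, and the age of \<open>R\<close> is
  determined by the downset of pointed structures that embed into \<open>(R, x)\<close>.\<close>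

section \<open>Well-quasi-orders\<close>

text \<open>For a quasi-order \<open>le\<close>, being a well-quasi-order on \<open>Q\<close> means
  that no such sequence exists; the property is used below in this form only.\<close>

definition bad_seq :: "('a \<Rightarrow> 'a \<Rightarrow> bool) \<Rightarrow> 'a set \<Rightarrow> (nat \<Rightarrow> 'a) \<Rightarrow> bool" where
  "bad_seq le Q s \<longleftrightarrow> range s \<subseteq> Q \<and> (\<forall>i j. i < j \<longrightarrow> \<not> le (s i) (s j))"

section \<open>Minimal bad sequences\<close>

text \<open>Nash-Williams' construction: position after position, pass to a bad sequence that keeps
  the earlier entries and has the least possible \<mu> at the current one. The diagonal of these
  choices is bad, since any two of its entries occur together in one of the chosen
  sequences.\<close>

lemma minimal_bad_seq:
  fixes \<mu> :: "'a \<Rightarrow> nat"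
  assumes "bad_seq le Q s0"
  obtains s where "bad_seq le Q s"
    "\<And>m u. bad_seq le Q u \<Longrightarrow> \<forall>i<m. u i = s i \<Longrightarrow> \<mu> (s m) \<le> \<mu> (u m)"
proof -
  \<comment> \<open>The first \<open>n\<close> entries of \<open>t\<close> are already optimal;
    nothing is required of the later ones except that \<open>t\<close> is bad.\<close>
  define P where "P n t \<longleftrightarrow> bad_seq le Q t \<and>
    (\<forall>m<n. \<forall>u. bad_seq le Q u \<longrightarrow> (\<forall>i<m. u i = t i) \<longrightarrow> \<mu> (t m) \<le> \<mu> (u m))" for n t
  have "\<exists>t. \<forall>n. P n (t n) \<and> (\<forall>i<n. t (Suc n) i = t n i)"
  proof (rule dependent_nat_choice)
    show "\<exists>t. P 0 t"
      using assms by (auto simp: P_def)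
  next
    fix t n
    assume t: "P n t"
    let ?B = "\<lambda>u. bad_seq le Q u \<and> (\<forall>i<n. u i = t i)"
    have "?B t"
      using t by (simp add: P_def)
    from ex_has_least_nat[of ?B, OF this, of "\<lambda>u. \<mu> (u n)"]
    obtain u where u: "?B u" and least: "\<And>v. ?B v \<Longrightarrow> \<mu> (u n) \<le> \<mu> (v n)"
      by blast
    have "P (Suc n) u"
      unfolding P_def
    proof (intro conjI allI impI)
      fix m v
      assume m: "m < Suc n" and v: "bad_seq le Q v" and agree: "\<forall>i<m. v i = u i"
      show "\<mu> (u m) \<le> \<mu> (v m)"
      proof (cases "m = n")
        case True
        then show ?thesis using least v agree u by simp
      next
        case False
        with m have "m < n" by simp
        then have "\<forall>i<m. v i = t i" "u m = t m" using agree u by auto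
        with t \<open>m < n\<close> v show ?thesis by (simp add: P_def)
      qed
    qed (use u in simp)
    then show "\<exists>u. P (Suc n) u \<and> (\<forall>i<n. u i = t i)"
      using u by blast
  qed
  then obtain t where P: "\<And>n. P n (t n)" and step: "\<And>n i. i < n \<Longrightarrow> t (Suc n) i = t n i"
    by blast
  have tbad: "bad_seq le Q (t n)" for n
    using P by (simp add: P_def)
  have stable: "t n i = t (Suc i) i" if "Suc i \<le> n" for n i
    using that by (induction n rule: dec_induct) (auto simp: step)
  \<comment> \<open>\<open>t (Suc i)\<close> is the first chosen sequence whose entry
    \<open>i\<close> is optimal, and by \<open>stable\<close> all later ones keep that
    entry.\<close>
  define s where "s i = t (Suc i) i" for i
  have eq: "s i = t n i" if "i < n" for i n
    using stable[of i n] that by (simp add: s_def)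
  show thesis
  proof (rule that)
    show "bad_seq le Q s"
      unfolding bad_seq_def
    proof (intro conjI allI impI subsetI)
      fix x assume "x \<in> range s"
      then show "x \<in> Q" using tbad by (auto simp: s_def bad_seq_def image_subset_iff)
    next
      fix i j :: nat
      assume "i < j"
      then show "\<not> le (s i) (s j)"
        using tbad[of "Suc j"] eq[of i "Suc j"] eq[of j "Suc j"] by (simp add: bad_seq_def)
    qed
    show "\<mu> (s m) \<le> \<mu> (u m)" if "bad_seq le Q u" "\<forall>i<m. u i = s i" for m u
      using P[of "Suc m"] eq[of _ "Suc m"] that by (simp add: P_def)
  qed
qed

text \<open>A bad sequence \<open>b\<close> of elements that lie below entries of \<open>s\<close>
  and are smaller than them could be spliced onto an initial segment of \<open>s\<close>. The result
  would be bad and would beat \<open>s\<close> at the splice point, against minimality.\<close>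

lemma no_bad_seq_of_parts:
  fixes \<mu> :: "'a \<Rightarrow> nat"
  assumes trans: "\<And>x y z. le x y \<Longrightarrow> le y z \<Longrightarrow> le x z"
    and bad: "bad_seq le Q s"
    and minimal: "\<And>m u. bad_seq le Q u \<Longrightarrow> \<forall>i<m. u i = s i \<Longrightarrow> \<mu> (s m) \<le> \<mu> (u m)"
  shows "\<not> bad_seq le {x \<in> Q. \<exists>i. le x (s i) \<and> \<mu> x < \<mu> (s i)} b"
proof
  assume b: "bad_seq le {x \<in> Q. \<exists>i. le x (s i) \<and> \<mu> x < \<mu> (s i)} b"
  then have "\<forall>j. \<exists>i. le (b j) (s i) \<and> \<mu> (b j) < \<mu> (s i)" and bQ: "\<And>j. b j \<in> Q"
    by (auto simp: bad_seq_def)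
  then obtain g where g: "\<And>j. le (b j) (s (g j)) \<and> \<mu> (b j) < \<mu> (s (g j))"
    by metis
  \<comment> \<open>The splice point is the least index \<open>g j0\<close>, so that every retained
    entry \<open>s i\<close> comes strictly before each \<open>s (g j)\<close>.\<close>
  obtain j0 where j0: "\<And>j. g j0 \<le> g j"
    using ex_has_least_nat[of "\<lambda>_. True" _ g] by blast
  define u where "u i = (if i < g j0 then s i else b (j0 + (i - g j0)))" for i
  have "bad_seq le Q u"
    unfolding bad_seq_def
  proof (intro conjI allI impI subsetI)
    fix x assume "x \<in> range u"
    then show "x \<in> Q" using bad bQ by (auto simp: u_def bad_seq_def split: if_splits)
  next
    fix i j :: nat
    assume ij: "i < j"
    consider "j < g j0" | "i < g j0" "\<not> j < g j0" | "\<not> i < g j0" "\<not> j < g j0"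
      using ij by linarith
    then show "\<not> le (u i) (u j)"
    proof cases
      case 1
      then show ?thesis using ij bad by (simp add: u_def bad_seq_def)
    next
      case 2
      \<comment> \<open>A comparison of \<open>s i\<close> with \<open>b j'\<close> would extend by
        transitivity to the later entry \<open>s (g j')\<close>, but \<open>s\<close> is
        bad.\<close>
      define j' where "j' = j0 + (j - g j0)"
      have "i < g j'" using 2 j0[of j'] by simp
      then have "\<not> le (s i) (s (g j'))" using bad by (simp add: bad_seq_def)
      then have "\<not> le (s i) (b j')" using trans g by blast
      then show ?thesis using 2 by (simp add: u_def j'_def)
    next
      case 3
      then show ?thesis using ij b by (simp add: u_def bad_seq_def)
    qed
  qed
  then have "\<mu> (s (g j0)) \<le> \<mu> (u (g j0))"
    by (rule minimal) (simp add: u_def)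
  with g[of j0] show False by (simp add: u_def)
qed

lemma bad_seq_subseq:
  assumes "infinite Y" "\<And>i. i \<in> Y \<Longrightarrow> f i \<in> Q"
    and "\<And>i j. i \<in> Y \<Longrightarrow> j \<in> Y \<Longrightarrow> i < j \<Longrightarrow> \<not> le (f i) (f j)"
  shows "bad_seq le Q (f \<circ> enumerate Y)"
  using assms enumerate_in_set[OF assms(1)] enumerate_mono[OF _ assms(1)]
  by (auto simp: bad_seq_def)

section \<open>Downsets of a well-quasi-order\<close>

text \<open>A downset is cut out by a finite set of forbidden elements from its complement, and a
  countable set has only countably many finite subsets.\<close>

lemma countable_downsets:
  assumes Q: "countable Q" and wqo: "\<And>s. \<not> bad_seq le Q s"
  shows "countable {D. D \<subseteq> Q \<and> (\<forall>x\<in>D. \<forall>y\<in>Q. le y x \<longrightarrow> y \<in> D)}" (is "countable ?\<D>")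
proof -
  have "D \<in> (\<lambda>F. {q \<in> Q. \<forall>f\<in>F. \<not> le f q}) ` {F. finite F \<and> F \<subseteq> Q}" if D: "D \<in> ?\<D>" for D
  proof -
    have "\<exists>F. finite F \<and> F \<subseteq> Q - D \<and> (\<forall>q\<in>Q - D. \<exists>f\<in>F. le f q)"
    proof (rule ccontr)
      \<comment> \<open>Without a finite set of forbidden elements one can keep choosing elements
        outside \<open>D\<close> that are above none of those chosen before; these choices form a
        bad sequence. In the recursion \<open>F n\<close> collects the elements chosen before step
        \<open>n\<close>.\<close>
      assume no: "\<not> ?thesis"
      have "\<exists>h. \<forall>n::nat. h n \<in> Q - D \<and> (\<forall>f \<in> h ` {..<n}. \<not> le f (h n))"
      proof -
        have *: "\<exists>q. q \<in> Q - D \<and> (\<forall>f\<in>F. \<not> le f q)" if "finite F" "F \<subseteq> Q - D" for F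
        proof (rule ccontr)
          assume "\<not> ?thesis"
          then have "\<forall>q\<in>Q - D. \<exists>f\<in>F. le f q" by blast
          with that have "finite F \<and> F \<subseteq> Q - D \<and> (\<forall>q\<in>Q - D. \<exists>f\<in>F. le f q)" by simp
          then have "\<exists>F. finite F \<and> F \<subseteq> Q - D \<and> (\<forall>q\<in>Q - D. \<exists>f\<in>F. le f q)" by (rule exI)
          with no show False by contradiction
        qed
        have "\<exists>F. \<forall>n. (finite (F n) \<and> F n \<subseteq> Q - D) \<and>
            (\<exists>q. q \<in> Q - D \<and> (\<forall>f\<in>F n. \<not> le f q) \<and> F (Suc n) = insert q (F n))"
        proof (rule dependent_nat_choice)
          show "\<exists>F. finite F \<and> F \<subseteq> Q - D" by (rule exI[of _ "{}"]) simp
          show "\<exists>F'. (finite F' \<and> F' \<subseteq> Q - D) \<and>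
              (\<exists>q. q \<in> Q - D \<and> (\<forall>f\<in>F. \<not> le f q) \<and> F' = insert q F)"
            if F: "finite F \<and> F \<subseteq> Q - D" for F and n :: nat
          proof -
            obtain q where q: "q \<in> Q - D" "\<forall>f\<in>F. \<not> le f q" using *[of F] F by metis
            with F show ?thesis by (intro exI[of _ "insert q F"] conjI exI[of _ q]) auto
          qed
        qed
        then obtain F where "\<forall>n. (finite (F n) \<and> F n \<subseteq> Q - D) \<and>
            (\<exists>q. q \<in> Q - D \<and> (\<forall>f\<in>F n. \<not> le f q) \<and> F (Suc n) = insert q (F n))" ..
        then have "\<forall>n. \<exists>q. q \<in> Q - D \<and> (\<forall>f\<in>F n. \<not> le f q) \<and> F (Suc n) = insert q (F n)"
          by simp
        from choice[OF this] obtain h where h: "\<And>n. h n \<in> Q - D" "\<And>n f. f \<in> F n \<Longrightarrow> \<not> le f (h n)"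
          "\<And>n. F (Suc n) = insert (h n) (F n)"
          by blast
        have sub: "h ` {..<n} \<subseteq> F n" for n
        proof (induction n)
          case (Suc n)
          then show ?case unfolding lessThan_Suc h(3) by blast
        qed simp
        show ?thesis
          by (intro exI[of _ h] allI conjI ballI h(1)) (rule h(2)[OF subsetD[OF sub]])
      qed
      then obtain h where "\<forall>n::nat. h n \<in> Q - D \<and> (\<forall>f \<in> h ` {..<n}. \<not> le f (h n))" ..
      then have "bad_seq le Q h" unfolding bad_seq_def by fast
      with wqo show False by blast
    qed
    then obtain F where F: "finite F" "F \<subseteq> Q - D" "\<forall>q\<in>Q - D. \<exists>f\<in>F. le f q" by blast
    then have "D = {q \<in> Q. \<forall>f\<in>F. \<not> le f q}" using D by blast
    then show ?thesis by (rule image_eqI) (use F in blast)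
  qed
  then have "?\<D> \<subseteq> (\<lambda>F. {q \<in> Q. \<forall>f\<in>F. \<not> le f q}) ` {F. finite F \<and> F \<subseteq> Q}" by (rule subsetI)
  then show ?thesis
    by (rule countable_subset) (intro countable_image countable_Collect_finite_subset Q)
qed

section \<open>Embeddings\<close>

definition embedding :: "nat \<Rightarrow> ('a \<Rightarrow> 'b) \<Rightarrow> 'a bstruct \<Rightarrow> 'b bstruct \<Rightarrow> bool" where
  "embedding k f S T \<longleftrightarrow> inj_on f (base S) \<and> f ` base S \<subseteq> base T \<and>
     (\<forall>i\<in>{1..k}. \<forall>x\<in>base S. \<forall>y\<in>base S. (x, y) \<in> rel S i \<longleftrightarrow> (f x, f y) \<in> rel T i)"

lemma base_restrict_to [simp]: "base (restrict_to R A) = base R \<inter> A"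
  and rel_restrict_to [simp]: "rel (restrict_to R A) i = rel R i \<inter> A \<times> A"
  by (simp_all add: restrict_to_def)

lemma restrict_to_restrict_to [simp]: "restrict_to (restrict_to R A) B = restrict_to R (A \<inter> B)"
  by (auto simp: restrict_to_def)

lemma is_bstruct_restrict_to: "is_bstruct k R \<Longrightarrow> is_bstruct k (restrict_to R A)"
  by (auto simp: is_bstruct_def)

lemma isomorphic_iff_embedding:
  "isomorphic k S T \<longleftrightarrow> (\<exists>f. embedding k f S T \<and> f ` base S = base T)"
  by (auto simp: isomorphic_def embedding_def bij_betw_def)

lemma isomorphic_sym:
  assumes "isomorphic k S T"
  shows "isomorphic k T S"
proof -
  obtain f where f: "bij_betw f (base S) (base T)"
    "\<forall>i\<in>{1..k}. \<forall>x\<in>base S. \<forall>y\<in>base S. (x, y) \<in> rel S i \<longleftrightarrow> (f x, f y) \<in> rel T i"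
    using assms by (auto simp: isomorphic_def)
  let ?g = "inv_into (base S) f"
  have g: "bij_betw ?g (base T) (base S)" using f(1) by (rule bij_betw_inv_into)
  have "?g x \<in> base S \<and> f (?g x) = x" if "x \<in> base T" for x
    using f(1) g that by (auto simp: bij_betw_def f_inv_into_f inv_into_into)
  with f(2) g show ?thesis unfolding isomorphic_def by (intro exI[of _ ?g]) force
qed

lemma embedding_comp: "embedding k f S T \<Longrightarrow> embedding k g T U \<Longrightarrow> embedding k (g \<circ> f) S U"
  unfolding embedding_def by (auto intro!: comp_inj_on elim: inj_on_subset simp: image_subset_iff)

lemma isomorphic_trans:
  assumes "isomorphic k S T" "isomorphic k T U"
  shows "isomorphic k S U"
proof -
  obtain f where f: "embedding k f S T" "f ` base S = base T"
    using assms(1) unfolding isomorphic_iff_embedding by blast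
  obtain g where g: "embedding k g T U" "g ` base T = base U"
    using assms(2) unfolding isomorphic_iff_embedding by blast
  have "(g \<circ> f) ` base S = base U" by (simp only: image_comp [symmetric] f(2) g(2))
  with embedding_comp[OF f(1) g(1)] show ?thesis unfolding isomorphic_iff_embedding by blast
qed

lemma iso_type_eqI: "isomorphic k S T \<Longrightarrow> iso_type k S = iso_type k T"
  unfolding iso_type_def by (auto intro: isomorphic_trans isomorphic_sym)

lemma embedding_restrict_to:
  "embedding k f S T \<Longrightarrow> embedding k f (restrict_to S F) (restrict_to T (f ` F))"
  by (auto simp: embedding_def inj_on_def image_subset_iff)

lemma embedding_restrict_toD: "embedding k f S (restrict_to T F) \<Longrightarrow> embedding k f S T"
  by (auto simp: embedding_def image_subset_iff)

lemma isomorphic_restrict_to_image: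
  assumes "embedding k f S T" "F \<subseteq> base S"
  shows "isomorphic k (restrict_to S F) (restrict_to T (f ` F))"
  unfolding isomorphic_iff_embedding
  using embedding_restrict_to[OF assms(1)] assms
  by (intro exI[of _ f]) (auto simp: embedding_def)

lemma isomorphic_restrict_to_range:
  assumes "embedding k f S T"
  shows "isomorphic k S (restrict_to T (f ` base S))"
  unfolding isomorphic_iff_embedding
  using assms by (intro exI[of _ f]) (auto simp: embedding_def)

lemma interval_isomorphic_image:
  assumes f: "bij_betw f (base S) (base T)"
    "\<forall>i\<in>{1..k}. \<forall>x\<in>base S. \<forall>y\<in>base S. (x, y) \<in> rel S i \<longleftrightarrow> (f x, f y) \<in> rel T i"
    and A: "interval k S A"
  shows "interval k T (f ` A)"
proof -
  have AS: "A \<subseteq> base S" using A by (simp add: interval_def)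
  have fS: "f ` base S = base T" using f(1) by (simp add: bij_betw_def)
  have "((x, a) \<in> rel T i \<longleftrightarrow> (x, a') \<in> rel T i) \<and> ((a, x) \<in> rel T i \<longleftrightarrow> (a', x) \<in> rel T i)"
    if i: "i \<in> {1..k}" and aa': "a \<in> f ` A" "a' \<in> f ` A" and x: "x \<in> base T - f ` A" for i a a' x
  proof -
    obtain c c' where c: "c \<in> A" "c' \<in> A" "a = f c" "a' = f c'" using aa' by blast
    obtain z where z: "z \<in> base S - A" "x = f z" using x fS by blast
    have "((z, c) \<in> rel S i \<longleftrightarrow> (z, c') \<in> rel S i) \<and> ((c, z) \<in> rel S i \<longleftrightarrow> (c', z) \<in> rel S i)"
      using A i c(1,2) z(1) unfolding interval_def by blast
    moreover have "c \<in> base S" "c' \<in> base S" "z \<in> base S" using c z AS by auto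
    ultimately show ?thesis using f(2) i c z by simp
  qed
  moreover have "f ` A \<subseteq> base T" using AS fS by blast
  ultimately show ?thesis unfolding interval_def by blast
qed

lemma indecomposable_isomorphic:
  assumes "isomorphic k S T" "indecomposable k T"
  shows "indecomposable k S"
proof -
  obtain f where f: "bij_betw f (base S) (base T)"
    "\<forall>i\<in>{1..k}. \<forall>x\<in>base S. \<forall>y\<in>base S. (x, y) \<in> rel S i \<longleftrightarrow> (f x, f y) \<in> rel T i"
    using assms by (auto simp: isomorphic_def)
  show ?thesis
    unfolding indecomposable_def
  proof (intro allI impI)
    fix A
    assume A: "interval k S A"
    then have sub: "A \<subseteq> base S" by (simp add: interval_def)
    have "f ` A = {} \<or> (\<exists>y\<in>base T. f ` A = {y}) \<or> f ` A = base T"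
      using interval_isomorphic_image[OF f A] assms(2) unfolding indecomposable_def by metis
    then consider "A = {}" | y where "f ` A = {y}" | "f ` A = base T"
      by auto
    then show "A = {} \<or> (\<exists>x\<in>base S. A = {x}) \<or> A = base S"
    proof cases
      case (2 y)
      then obtain x where x: "x \<in> A" "f x = y" by blast
      have "z = x" if "z \<in> A" for z
      proof (rule inj_onD[OF bij_betw_imp_inj_on[OF f(1)]])
        show "f z = f x" using 2 x that by blast
      qed (use x that sub in auto)
      then have "A = {x}" using x(1) by blast
      then show ?thesis using sub by blast
    next
      case 3
      then have "f ` A = f ` base S" using f(1) by (simp add: bij_betw_def)
      then have "A = base S"
        using inj_on_image_eq_iff[OF bij_betw_imp_inj_on[OF f(1)] sub order_refl] by simp
      then show ?thesis by simp
    qed simp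
  qed
qed

text \<open>Ages consist of isomorphism types over the natural numbers, whereas \<open>R\<close> may
  live on any type; this is the passage between the two.\<close>

lemma obtain_nat_copy:
  fixes R :: "'a bstruct"
  assumes "F \<subseteq> base R" "finite F"
  obtains T :: "nat bstruct" and g where "is_bstruct k T" "finite (base T)" "embedding k g T R"
    "g ` base T = F"
proof -
  obtain g where g: "bij_betw g {0..<card F} F"
    using ex_bij_betw_nat_finite[OF assms(2)] by blast
  define T where "T = BStruct {0..<card F}
    (\<lambda>i. if i \<in> {1..k} then {(a, b) \<in> {0..<card F} \<times> {0..<card F}. (g a, g b) \<in> rel R i} else {})"
  show thesis
  proof (rule that)
    show "is_bstruct k T" "finite (base T)" by (auto simp: T_def is_bstruct_def)
    show "embedding k g T R" "g ` base T = F"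
      using g assms(1) by (auto simp: T_def embedding_def bij_betw_def)
  qed
qed

section \<open>Pointed structures\<close>

definition pointed_embeds :: "nat \<Rightarrow> 'a bstruct \<times> 'a \<Rightarrow> 'b bstruct \<times> 'b \<Rightarrow> bool" where
  "pointed_embeds k X Y \<longleftrightarrow> (\<exists>f. embedding k f (fst X) (fst Y) \<and> f (snd X) = snd Y)"

text \<open>Only restrictions avoiding the point are bounded. This fits a kernel point
  \<open>x\<close> of \<open>R\<close>: the indecomposable restrictions of \<open>R\<close> avoiding
  \<open>x\<close> have bounded size, while those of \<open>R\<close> itself do not when its age is
  ind-minimal.\<close>

definition pointed_bounded :: "nat \<Rightarrow> nat \<Rightarrow> ('a bstruct \<times> 'a) set" where
  "pointed_bounded k n = {(S, p). is_bstruct k S \<and> finite (base S) \<and> p \<in> base S \<and>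
     (\<forall>F \<subseteq> base S - {p}. indecomposable k (restrict_to S F) \<longrightarrow> card F \<le> n)}"

section \<open>Decomposition into intervals\<close>

definition retraction :: "nat \<Rightarrow> 'a bstruct \<Rightarrow> 'a set \<Rightarrow> ('a \<Rightarrow> 'a) \<Rightarrow> bool" where
  "retraction k S V b \<longleftrightarrow> b ` V \<subseteq> V \<and> (\<forall>x\<in>V. b (b x) = b x) \<and>
     (\<forall>i\<in>{1..k}. \<forall>x\<in>V. \<forall>y\<in>V. b x \<noteq> b y \<longrightarrow> ((x, y) \<in> rel S i \<longleftrightarrow> (b x, b y) \<in> rel S i))"

lemma pointed_embeds_trans:
  assumes "pointed_embeds k X Y" "pointed_embeds k Y Z"
  shows "pointed_embeds k X Z"
proof -
  obtain f where f: "embedding k f (fst X) (fst Y)" "f (snd X) = snd Y"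
    using assms(1) unfolding pointed_embeds_def by blast
  obtain g where g: "embedding k g (fst Y) (fst Z)" "g (snd Y) = snd Z"
    using assms(2) unfolding pointed_embeds_def by blast
  have "(g \<circ> f) (snd X) = snd Z" using f g by simp
  with embedding_comp[OF f(1) g(1)] show ?thesis unfolding pointed_embeds_def by blast
qed

text \<open>The fibres of a retraction form a partition into intervals.  When the number of fibres is
  least possible but at least two, an interval of the quotient could be merged into a single
  fibre, so the quotient is indecomposable.\<close>

lemma obtain_indecomposable_quotient:
  assumes "finite V" "2 \<le> card V" "V \<subseteq> base S"
  obtains b where "retraction k S V b" "2 \<le> card (b ` V)" "indecomposable k (restrict_to S (b ` V))"
proof -
  let ?P = "\<lambda>b. retraction k S V b \<and> 2 \<le> card (b ` V)"
  \<comment> \<open>The identity, with singleton fibres, shows that there is something to minimise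
    over.\<close>
  have "?P id" using assms by (simp add: retraction_def)
  from ex_has_least_nat[of ?P, OF this, of "\<lambda>b. card (b ` V)"]
  obtain b where b: "retraction k S V b" "2 \<le> card (b ` V)"
    and least: "\<And>c. ?P c \<Longrightarrow> card (b ` V) \<le> card (c ` V)" by blast
  have bV: "b ` V \<subseteq> V" and idem: "\<And>x. x \<in> V \<Longrightarrow> b (b x) = b x"
    and rels: "\<And>i x y. i \<in> {1..k} \<Longrightarrow> x \<in> V \<Longrightarrow> y \<in> V \<Longrightarrow> b x \<noteq> b y \<Longrightarrow>
      (x, y) \<in> rel S i \<longleftrightarrow> (b x, b y) \<in> rel S i"
    using b(1) by (auto simp: retraction_def)
  have base: "base (restrict_to S (b ` V)) = b ` V" using bV assms(3) by auto
  have "indecomposable k (restrict_to S (b ` V))"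
    unfolding indecomposable_def base
  proof (intro allI impI, rule ccontr)
    fix A
    assume A: "interval k (restrict_to S (b ` V)) A"
      and nontriv: "\<not> (A = {} \<or> (\<exists>x\<in>b ` V. A = {x}) \<or> A = b ` V)"
    have sub: "A \<subseteq> b ` V" using A unfolding interval_def base by blast
    have int: "((z, x) \<in> rel S i \<longleftrightarrow> (z, y) \<in> rel S i) \<and> ((x, z) \<in> rel S i \<longleftrightarrow> (y, z) \<in> rel S i)"
      if "i \<in> {1..k}" "x \<in> A" "y \<in> A" "z \<in> b ` V - A" for i x y z
    proof -
      let ?S = "restrict_to S (b ` V)"
      have "((z, x) \<in> rel ?S i \<longleftrightarrow> (z, y) \<in> rel ?S i) \<and> ((x, z) \<in> rel ?S i \<longleftrightarrow> (y, z) \<in> rel ?S i)"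
        using A that unfolding interval_def base by blast
      moreover have "x \<in> b ` V" "y \<in> b ` V" "z \<in> b ` V" using that sub by auto
      ultimately show ?thesis by simp
    qed
    obtain a a' where a: "a \<in> A" "a' \<in> A" "a \<noteq> a'" using nontriv sub by blast
    obtain z where z: "z \<in> b ` V - A" using nontriv sub by blast
    \<comment> \<open>All fibres over the interval \<open>A\<close> are merged into one with
      representative \<open>a\<close>. The image loses \<open>a'\<close> but still contains
      \<open>a\<close> and \<open>z\<close>, so it is smaller than that of \<open>b\<close> and yet
      has at least two elements.\<close>
    define c where "c x = (if b x \<in> A then a else b x)" for x
    have ba: "b a = a" "b a' = a'" "b z = z" using sub a z idem by auto
    have inV: "a \<in> V" "a' \<in> V" "z \<in> V" using sub a z bV by auto
    have "retraction k S V c"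
      unfolding retraction_def
    proof (intro conjI ballI impI)
      show "c ` V \<subseteq> V" using bV inV by (auto simp: c_def)
      show "c (c x) = c x" if "x \<in> V" for x
        using that idem ba a by (simp add: c_def)
      fix i x y
      assume i: "i \<in> {1..k}" and xy: "x \<in> V" "y \<in> V" and ne: "c x \<noteq> c y"
      from ne have "b x \<noteq> b y" by (metis c_def)
      with rels i xy have "(x, y) \<in> rel S i \<longleftrightarrow> (b x, b y) \<in> rel S i" by blast
      also have "\<dots> \<longleftrightarrow> (c x, c y) \<in> rel S i"
        using ne xy int[OF i _ a(1)] by (auto simp: c_def split: if_splits)
      finally show "(x, y) \<in> rel S i \<longleftrightarrow> (c x, c y) \<in> rel S i" .
    qed
    moreover have "2 \<le> card (c ` V)"
    proof -
      have "c a = a" "c z = z" using ba a z by (auto simp: c_def)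
      then have "{a, z} \<subseteq> c ` V" using inV by (metis empty_subsetI image_eqI insert_subset)
      moreover have "a \<noteq> z" using a z by blast
      then have "card {a, z} = 2" by simp
      ultimately show ?thesis using card_mono[of "c ` V" "{a, z}"] assms(1) by simp
    qed
    moreover have "card (c ` V) < card (b ` V)"
    proof (rule psubset_card_mono)
      show "finite (b ` V)" using assms(1) by simp
      have "a' \<in> b ` V" "a' \<notin> c ` V" using a sub by (auto simp: c_def)
      moreover have "c ` V \<subseteq> b ` V" using a sub by (auto simp: c_def)
      ultimately show "c ` V \<subset> b ` V" by blast
    qed
    ultimately show False using least[of c] by simp
  qed
  with b that show thesis by blast
qed

lemma pointed_bounded_restrict_to:
  assumes "(S, p) \<in> pointed_bounded k n"
  shows "(restrict_to S (insert p B), p) \<in> pointed_bounded k n"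
proof -
  have "card F \<le> n" if "F \<subseteq> base S \<inter> insert p B - {p}"
    "indecomposable k (restrict_to S (insert p B \<inter> F))" for F
  proof -
    have "insert p B \<inter> F = F" "F \<subseteq> base S - {p}" using that(1) by auto
    with that(2) assms show ?thesis by (simp add: pointed_bounded_def)
  qed
  with assms show ?thesis by (auto simp: pointed_bounded_def is_bstruct_restrict_to)
qed

lemma pointed_embeds_restrict_to: "pointed_embeds k (restrict_to S A, p) (S, p)"
  unfolding pointed_embeds_def by (intro exI[of _ id]) (auto simp: embedding_def)

section \<open>Finite codes and the pigeonhole principle\<close>

lemma infinite_fibre_of_finite_range:
  assumes "infinite (I :: nat set)" "finite C" "\<And>i. i \<in> I \<Longrightarrow> f i \<in> C"
  shows "\<exists>J c. infinite J \<and> J \<subseteq> I \<and> (\<forall>i\<in>J. f i = c)"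
proof -
  have "finite (f ` I)" using assms(2,3) by (meson finite_subset image_subsetI)
  from pigeonhole_infinite[OF assms(1) this] obtain c where "infinite {i \<in> I. f i = f c}" by blast
  then show ?thesis by (intro exI[of _ "{i \<in> I. f i = f c}"] exI[of _ "f c"]) blast
qed

text \<open>The relations among \<open>h 0, ..., h (m - 1)\<close>, pulled back to the indices. For
  bounded \<open>m\<close> there are only finitely many values, so infinitely many structures share
  one.\<close>

definition diagram :: "nat \<Rightarrow> 'a bstruct \<Rightarrow> nat \<Rightarrow> (nat \<Rightarrow> 'a) \<Rightarrow> (nat \<times> nat \<times> nat) set" where
  "diagram k S m h = {(i, a, b). i \<in> {1..k} \<and> a < m \<and> b < m \<and> (h a, h b) \<in> rel S i}"

lemma diagram_in: "m \<le> n \<Longrightarrow> diagram k S m h \<in> Pow ({1..k} \<times> {..<n} \<times> {..<n})"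
  by (auto simp: diagram_def)

text \<open>Up to isomorphism there are finitely many pointed structures of size at most
  \<open>N\<close>: size, position of the point and diagram of an enumeration determine one. Two
  indices with equal codes give the required embedding.\<close>

lemma no_bad_seq_small:
  assumes I: "infinite (I :: nat set)"
    and s: "\<And>i. i \<in> I \<Longrightarrow> finite (base (fst (s i))) \<and> card (base (fst (s i))) \<le> N \<and>
      snd (s i) \<in> base (fst (s i))"
  shows "\<exists>i\<in>I. \<exists>j\<in>I. i < j \<and> pointed_embeds k (s i) (s j)"
proof -
  define S where "S i = fst (s i)" for i
  define p where "p i = snd (s i)" for i
  have "\<exists>h. bij_betw h {..<card (base (S i))} (base (S i))" if "i \<in> I" for i
    using ex_bij_betw_nat_finite[of "base (S i)"] s[OF that] by (simp add: S_def lessThan_atLeast0)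
  then obtain h where h: "\<And>i. i \<in> I \<Longrightarrow> bij_betw (h i) {..<card (base (S i))} (base (S i))"
    by metis
  have "\<exists>a<card (base (S i)). h i a = p i" if "i \<in> I" for i
    using h[OF that] s[OF that] unfolding bij_betw_def S_def p_def by (metis imageE lessThan_iff)
  then obtain q where q: "\<And>i. i \<in> I \<Longrightarrow> q i < card (base (S i)) \<and> h i (q i) = p i"
    by metis
  define code where "code i = (card (base (S i)), q i, diagram k (S i) (card (base (S i))) (h i))" for i
  let ?C = "{..N} \<times> {..<N} \<times> Pow ({1..k} \<times> {..<N} \<times> {..<N})"
  have code: "code i \<in> ?C" if "i \<in> I" for i
    using s[OF that] q[OF that] diagram_in[of _ N k "S i" "h i"]
    unfolding code_def S_def by (auto simp del: Pow_iff)
  have "finite ?C" by simp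
  have "\<exists>J c. infinite J \<and> J \<subseteq> I \<and> (\<forall>i\<in>J. code i = c)"
    by (rule infinite_fibre_of_finite_range[OF I \<open>finite ?C\<close>]) (rule code)
  then obtain J c where J: "infinite J" "J \<subseteq> I" "\<forall>i\<in>J. code i = c"
    by (elim exE conjE) (rule that)
  obtain i where i: "i \<in> J" using J(1) by fastforce
  obtain j where j: "j \<in> J" "i < j" using J(1) infinite_nat_iff_unbounded by blast
  \<comment> \<open>Elements at the same position of the two enumerations are matched.\<close>
  define f where "f x = h j (inv_into {..<card (base (S i))} (h i) x)" for x
  have ij: "i \<in> I" "j \<in> I" using subsetD[OF J(2)] i j(1) by simp_all
  have "code j = code i" using bspec[OF J(3) i] bspec[OF J(3) j(1)] by (rule trans[OF _ sym, rotated])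
  then have eq: "card (base (S j)) = card (base (S i))" "q j = q i"
    and diag: "diagram k (S j) (card (base (S j))) (h j) = diagram k (S i) (card (base (S i))) (h i)"
    unfolding code_def by blast+
  define M where "M = card (base (S i))"
  have hi: "bij_betw (h i) {..<M} (base (S i))" using h[OF ij(1)] by (simp add: M_def)
  have hj: "bij_betw (h j) {..<M} (base (S j))" using h[OF ij(2)] eq by (simp add: M_def)
  have fh: "f (h i a) = h j a" if "a < M" for a
    using hi that unfolding M_def by (simp add: f_def bij_betw_def inv_into_f_f)
  have base: "base (S i) = h i ` {..<M}" using hi by (simp add: bij_betw_def)
  have "embedding k f (S i) (S j)"
    unfolding embedding_def
  proof (intro conjI ballI)
    show "f ` base (S i) \<subseteq> base (S j)"
      using fh hj unfolding base by (auto simp: bij_betw_def)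
    show "inj_on f (base (S i))"
      using fh hj unfolding base bij_betw_def inj_on_def by auto
    fix r x y
    assume r: "r \<in> {1..k}" and xy: "x \<in> base (S i)" "y \<in> base (S i)"
    obtain a b where ab: "a < M" "b < M" "x = h i a" "y = h i b" using xy base by blast
    have "(r, a, b) \<in> diagram k (S i) M (h i) \<longleftrightarrow> (r, a, b) \<in> diagram k (S j) M (h j)"
      using diag eq by (simp add: M_def)
    then show "(x, y) \<in> rel (S i) r \<longleftrightarrow> (f x, f y) \<in> rel (S j) r"
      using r ab fh by (simp add: diagram_def)
  qed
  moreover have "f (p i) = p j" using q[OF ij(1)] q[OF ij(2)] eq(2) fh[of "q i"] by (simp add: M_def)
  ultimately have "pointed_embeds k (s i) (s j)"
    unfolding pointed_embeds_def S_def p_def by (intro exI[of _ f] conjI)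
  with ij j(2) show ?thesis by blast
qed

text \<open>The distinguished point belongs to every part, so its relations to the other elements are
  respected by embeddings of the parts and need not be recorded in the diagrams.\<close>

lemma pointed_embeds_glue:
  assumes b: "retraction k S (base S - {p}) b" and c: "retraction k T (base T - {q}) c"
    and pq: "p \<in> base S" "q \<in> base T" and m: "0 < m"
    and h: "h ` {..<m} = b ` (base S - {p})" "inj_on h {..<m}"
    and g: "g ` {..<m} = c ` (base T - {q})" "inj_on g {..<m}"
    and diag: "diagram k S m h = diagram k T m g"
    and parts: "\<And>l. l < m \<Longrightarrow>
      pointed_embeds k (restrict_to S (insert p {x \<in> base S - {p}. b x = h l}), p)
        (restrict_to T (insert q {x \<in> base T - {q}. c x = g l}), q)"
  shows "pointed_embeds k (S, p) (T, q)"
proof -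
  define B where "B l = {x \<in> base S - {p}. b x = h l}" for l
  define C where "C l = {x \<in> base T - {q}. c x = g l}" for l
  have "\<forall>l. \<exists>f. l < m \<longrightarrow> embedding k f (restrict_to S (insert p (B l)))
      (restrict_to T (insert q (C l))) \<and> f p = q"
    using parts unfolding pointed_embeds_def B_def C_def fst_conv snd_conv by blast
  from choice[OF this] obtain f where f: "\<And>l. l < m \<Longrightarrow>
      embedding k (f l) (restrict_to S (insert p (B l))) (restrict_to T (insert q (C l))) \<and> f l p = q"
    by blast
  have base: "base S \<inter> insert p (B l) = insert p (B l)" "base T \<inter> insert q (C l) = insert q (C l)" for l
    using pq by (auto simp: B_def C_def)
  have finj: "inj_on (f l) (insert p (B l))" and fp: "f l p = q"
    and fsub: "f l ` insert p (B l) \<subseteq> insert q (C l)" if "l < m" for l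
    using f[OF that] by (auto simp: embedding_def base)
  have frel: "(x, y) \<in> rel S i \<longleftrightarrow> (f l x, f l y) \<in> rel T i"
    if "l < m" "i \<in> {1..k}" "x \<in> insert p (B l)" "y \<in> insert p (B l)" for l i x y
    using f[OF that(1)] that fsub[OF that(1)] unfolding embedding_def base_restrict_to base
    by (auto simp: image_subset_iff)
  \<comment> \<open>Since \<open>f l\<close> is injective and sends \<open>p\<close> to
    \<open>q\<close>, it keeps all other elements of the part away from \<open>q\<close>.\<close>
  have fB: "f l x \<in> C l" if "l < m" "x \<in> B l" for l x
  proof -
    have "f l x \<in> insert q (C l)" using fsub that by blast
    moreover have "f l x \<noteq> q"
    proof
      assume "f l x = q"
      then have "x = p" using finj[OF that(1)] fp[OF that(1)] that(2) by (auto dest: inj_onD)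
      then show False using that(2) by (simp add: B_def)
    qed
    ultimately show ?thesis by blast
  qed
  \<comment> \<open>\<open>d x\<close> is the index of the part containing \<open>x\<close>; on that
    part the glued map \<open>F\<close> below follows the given embedding.\<close>
  define d where "d x = inv_into {..<m} h (b x)" for x
  have d: "d x < m \<and> x \<in> B (d x)" if "x \<in> base S - {p}" for x
  proof -
    have bx: "b x \<in> h ` {..<m}" using h(1) that by blast
    then have "d x \<in> {..<m}" unfolding d_def by (rule inv_into_into)
    moreover have "h (d x) = b x" unfolding d_def using bx by (rule f_inv_into_f)
    ultimately show ?thesis using that by (simp add: B_def)
  qed
  define F where "F x = (if x = p then q else f (d x) x)" for x
  have Fp: "F p = q" by (simp add: F_def)
  have FC: "F x \<in> C (d x)" if "x \<in> base S - {p}" for x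
    using that d fB by (simp add: F_def)
  have Cdisj: "l = l'" if "y \<in> C l" "y \<in> C l'" "l < m" "l' < m" for y l l'
    using that g(2) by (auto simp: C_def inj_on_def)
  have "inj_on F (base S)"
  proof (rule inj_onI)
    fix x y
    assume xy: "x \<in> base S" "y \<in> base S" "F x = F y"
    have qC: "q \<notin> C l" for l by (simp add: C_def)
    consider "x = p" "y = p" | "x = p" "y \<noteq> p" | "x \<noteq> p" "y = p" | "x \<noteq> p" "y \<noteq> p" by blast
    then show "x = y"
    proof cases
      case 2
      then show ?thesis using FC[of y] xy Fp qC[of "d y"] by simp
    next
      case 3
      then show ?thesis using FC[of x] xy Fp qC[of "d x"] by simp
    next
      case 4
      then have V: "x \<in> base S - {p}" "y \<in> base S - {p}" using xy by auto
      have "d x = d y" using Cdisj[of "F x" "d x" "d y"] FC[OF V(1)] FC[OF V(2)] d[OF V(1)] d[OF V(2)] xy(3) by simp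
      moreover have "f (d x) x = f (d y) y" using xy(3) 4 by (simp add: F_def)
      ultimately show ?thesis using finj[of "d x"] d[OF V(1)] d[OF V(2)] by (auto dest: inj_onD)
    qed simp
  qed
  moreover have "F ` base S \<subseteq> base T"
    using FC pq by (auto simp: C_def F_def)
  moreover have "(x, y) \<in> rel S i \<longleftrightarrow> (F x, F y) \<in> rel T i"
    if i: "i \<in> {1..k}" and xy: "x \<in> base S" "y \<in> base S" for i x y
  proof -
    have same: ?thesis if "l < m" "x \<in> insert p (B l)" "y \<in> insert p (B l)" "F x = f l x" "F y = f l y" for l
      using frel[OF that(1) i that(2,3)] that by simp
    consider "x = p" "y = p" | "x = p" "y \<noteq> p" | "x \<noteq> p" "y = p"
      | "x \<noteq> p" "y \<noteq> p" "d x = d y" | "x \<noteq> p" "y \<noteq> p" "d x \<noteq> d y" by blast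
    then show ?thesis
    proof cases
      \<comment> \<open>Every part contains \<open>p\<close>, so any index would serve;
        \<open>0 < m\<close> supplies one.\<close>
      case 1
      then show ?thesis using same[OF m] fp[OF m] by (simp add: F_def)
    next
      case 2
      then show ?thesis using same[of "d y"] d[of y] fp[of "d y"] xy by (simp add: F_def)
    next
      case 3
      then show ?thesis using same[of "d x"] d[of x] fp[of "d x"] xy by (simp add: F_def)
    next
      case 4
      then show ?thesis using same[of "d x"] d[of x] d[of y] xy by (simp add: F_def)
    next
      \<comment> \<open>Between different parts the relations are those of the representatives, on
        both sides, and the equal diagrams identify these.\<close>
      case 5
      then have V: "x \<in> base S - {p}" "y \<in> base S - {p}" using xy by auto
      note dx = d[OF V(1)] and dy = d[OF V(2)]
      have bx: "b x = h (d x)" "b y = h (d y)" using dx dy by (auto simp: B_def)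
      have cx: "c (F x) = g (d x)" "c (F y) = g (d y)" "F x \<in> base T - {q}" "F y \<in> base T - {q}"
        using FC[OF V(1)] FC[OF V(2)] by (auto simp: C_def)
      have "h (d x) \<noteq> h (d y)" "g (d x) \<noteq> g (d y)"
        using h(2) g(2) dx dy 5 by (auto dest: inj_onD)
      then have "(x, y) \<in> rel S i \<longleftrightarrow> (h (d x), h (d y)) \<in> rel S i"
        "(F x, F y) \<in> rel T i \<longleftrightarrow> (g (d x), g (d y)) \<in> rel T i"
        using b c V i cx bx unfolding retraction_def by metis+
      moreover have "(i, d x, d y) \<in> diagram k S m h \<longleftrightarrow> (i, d x, d y) \<in> diagram k T m g"
        using diag by simp
      ultimately show ?thesis using dx dy i by (simp add: diagram_def)
    qed
  qed
  ultimately have "embedding k F S T" by (simp add: embedding_def)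
  with Fp show ?thesis unfolding pointed_embeds_def by auto
qed

section \<open>Well-quasi-ordering of bounded pointed structures\<close>

text \<open>More than two elements leave at least two besides \<open>p\<close>, so there is an
  indecomposable quotient with at least two fibres. Its representatives form an indecomposable
  restriction avoiding \<open>p\<close>, whence at most \<open>n\<close> fibres.\<close>

lemma obtain_decomposition:
  assumes Sp: "(S, p) \<in> pointed_bounded k n" and card: "2 < card (base S)"
  obtains b m h where "retraction k S (base S - {p}) b" "2 \<le> m" "m \<le> n"
    "h ` {..<m} = b ` (base S - {p})" "inj_on h {..<m}"
proof -
  let ?V = "base S - {p}"
  have fin: "finite (base S)" and p: "p \<in> base S"
    and bound: "\<And>F. F \<subseteq> ?V \<Longrightarrow> indecomposable k (restrict_to S F) \<Longrightarrow> card F \<le> n"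
    using Sp by (auto simp: pointed_bounded_def)
  have "finite ?V" "2 \<le> card ?V" "?V \<subseteq> base S" using fin p card by auto
  then obtain b where b: "retraction k S ?V b" "2 \<le> card (b ` ?V)"
    "indecomposable k (restrict_to S (b ` ?V))"
    by (rule obtain_indecomposable_quotient)
  have "card (b ` ?V) \<le> n" using b bound by (simp add: retraction_def)
  moreover obtain h where "bij_betw h {0..<card (b ` ?V)} (b ` ?V)"
    using ex_bij_betw_nat_finite[of "b ` ?V"] fin by blast
  ultimately show thesis
    using that[of b "card (b ` ?V)" h] b by (simp add: bij_betw_def lessThan_atLeast0)
qed

text \<open>In a minimal bad sequence, infinitely many entries split into the same number
  \<open>m0\<close> of parts with the same diagram between them. Ramsey's theorem, applied to the
  first part that fails to embed, leaves two outcomes: one fixed part always fails, which yields a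
  bad sequence of smaller structures, or all parts embed and can be glued.\<close>

lemma pointed_bounded_wqo: "\<not> bad_seq (pointed_embeds k) (pointed_bounded k n) s"
proof (rule notI, erule minimal_bad_seq[where \<mu> = "\<lambda>X. card (base (fst X))"])
  fix s
  assume bad: "bad_seq (pointed_embeds k) (pointed_bounded k n) s"
    and minimal: "\<And>m u. bad_seq (pointed_embeds k) (pointed_bounded k n) u \<Longrightarrow>
      \<forall>i<m. u i = s i \<Longrightarrow> card (base (fst (s m))) \<le> card (base (fst (u m)))"
  define S where "S i = fst (s i)" for i
  define p where "p i = snd (s i)" for i
  have s: "(S i, p i) \<in> pointed_bounded k n" for i
    using bad by (auto simp: bad_seq_def S_def p_def)
  have notle: "\<not> pointed_embeds k (S i, p i) (S j, p j)" if "i < j" for i j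
    using bad that by (simp add: bad_seq_def S_def p_def)
  have fin: "finite (base (S i))" and pS: "p i \<in> base (S i)" for i
    using s[of i] by (auto simp: pointed_bounded_def)
  \<comment> \<open>Entries too small to be decomposed occur only finitely often, because infinitely
    many of them would contain a comparable pair.\<close>
  have "finite {i. card (base (S i)) \<le> 2}"
  proof (rule ccontr)
    assume inf: "infinite {i. card (base (S i)) \<le> 2}"
    have "\<exists>i\<in>{i. card (base (S i)) \<le> 2}. \<exists>j\<in>{i. card (base (S i)) \<le> 2}.
        i < j \<and> pointed_embeds k (s i) (s j)"
      by (rule no_bad_seq_small[OF inf, where N = 2]) (use fin pS in \<open>simp add: S_def p_def\<close>)
    with bad show False unfolding bad_seq_def by blast
  qed
  let ?I = "{i. 2 < card (base (S i))}"
  have "UNIV - {i. card (base (S i)) \<le> 2} = ?I" by auto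
  then have I: "infinite ?I"
    using \<open>finite {i. card (base (S i)) \<le> 2}\<close> by (metis Diff_infinite_finite infinite_UNIV_nat)
  have "\<exists>b m h. retraction k (S i) (base (S i) - {p i}) b \<and> 2 \<le> m \<and> m \<le> n \<and>
      h ` {..<m} = b ` (base (S i) - {p i}) \<and> inj_on h {..<m}" if "i \<in> ?I" for i
    using obtain_decomposition[OF s[of i]] that by (metis mem_Collect_eq)
  then obtain b m h where decomp: "\<And>i. i \<in> ?I \<Longrightarrow> retraction k (S i) (base (S i) - {p i}) (b i) \<and>
      2 \<le> m i \<and> m i \<le> n \<and> h i ` {..<m i} = b i ` (base (S i) - {p i}) \<and> inj_on (h i) {..<m i}"
    by metis
  define part where "part l i =
    (restrict_to (S i) (insert (p i) {x \<in> base (S i) - {p i}. b i x = h i l}), p i)" for l i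
  let ?C = "{..n} \<times> Pow ({1..k} \<times> {..<n} \<times> {..<n})"
  have code: "(m i, diagram k (S i) (m i) (h i)) \<in> ?C" if "i \<in> ?I" for i
    using decomp[OF that] diagram_in[of "m i" n k "S i" "h i"] by (auto simp del: Pow_iff)
  have "finite ?C" by simp
  have "\<exists>J c. infinite J \<and> J \<subseteq> ?I \<and> (\<forall>i\<in>J. (m i, diagram k (S i) (m i) (h i)) = c)"
    by (rule infinite_fibre_of_finite_range[OF I \<open>finite ?C\<close>]) (rule code)
  then obtain J c where J: "infinite J" "J \<subseteq> ?I"
    "\<forall>i\<in>J. (m i, diagram k (S i) (m i) (h i)) = c"
    by (elim exE conjE) (rule that)
  define m0 where "m0 = fst c"
  have m0: "m i = m0" "diagram k (S i) m0 (h i) = snd c" if "i \<in> J" for i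
    using bspec[OF J(3) that] unfolding m0_def by (metis fst_conv, metis fst_conv snd_conv)
  have d: "retraction k (S i) (base (S i) - {p i}) (b i)" "2 \<le> m0"
    "h i ` {..<m0} = b i ` (base (S i) - {p i})" "inj_on (h i) {..<m0}" if "i \<in> J" for i
    using decomp[OF subsetD[OF J(2) that]] unfolding m0(1)[OF that] by simp_all
  \<comment> \<open>the first part that fails to embed, or \<open>m0\<close> if there is none\<close>
  define colour where "colour X =
    (LEAST l. l = m0 \<or> \<not> pointed_embeds k (part l (Min X)) (part l (Max X)))" for X
  have colour_le: "colour X \<le> m0" for X
    unfolding colour_def by (rule Least_le) simp
  have "\<forall>x\<in>J. \<forall>y\<in>J. x \<noteq> y \<longrightarrow> colour {x, y} < Suc m0"
    using colour_le by (simp add: less_Suc_eq_le)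
  \<comment> \<open>There are \<open>Suc m0\<close> colours: the \<open>m0\<close> parts and the
    value \<open>m0\<close> for no failure.\<close>
  from Ramsey2[OF J(1) this] obtain Y t where Y: "Y \<subseteq> J" "infinite Y"
    and Yt: "\<forall>x\<in>Y. \<forall>y\<in>Y. x \<noteq> y \<longrightarrow> colour {x, y} = t"
    by (elim exE conjE) (rule that)
  have t: "colour {x, y} = t" if "x \<in> Y" "y \<in> Y" "x \<noteq> y" for x y
    using Yt that by blast
  define i where "i = enumerate Y 0"
  define j where "j = enumerate Y 1"
  have ij: "i \<in> Y" "j \<in> Y" "i < j"
    unfolding i_def j_def by (simp_all add: enumerate_in_set enumerate_mono Y(2) del: enumerate_0)
  have minmax: "Min {x, y} = x" "Max {x, y} = y" if "x < y" for x y :: nat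
    using that by auto
  show False
  proof (cases "t < m0")
    \<comment> \<open>Part \<open>t\<close> fails between any two members of \<open>Y\<close>, so
      along \<open>Y\<close> these parts form a bad sequence.\<close>
    case True
    have "bad_seq (pointed_embeds k)
      {x \<in> pointed_bounded k n. \<exists>i. pointed_embeds k x (s i) \<and> card (base (fst x)) < card (base (fst (s i)))}
      (part t \<circ> enumerate Y)"
    proof (rule bad_seq_subseq[OF Y(2)])
      fix i j
      assume ij: "i \<in> Y" "j \<in> Y" "i < j"
      have "colour {i, j} = m0 \<or> \<not> pointed_embeds k (part (colour {i, j}) i) (part (colour {i, j}) j)"
        using LeastI[of "\<lambda>l. l = m0 \<or> \<not> pointed_embeds k (part l i) (part l j)" m0] ij
        by (simp add: colour_def)
      then show "\<not> pointed_embeds k (part t i) (part t j)" using t[of i j] ij True by simp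
    next
      fix i
      assume "i \<in> Y"
      then have i: "i \<in> J" using Y by blast
      let ?B = "{x \<in> base (S i) - {p i}. b i x = h i t}"
      \<comment> \<open>As \<open>m0\<close> is at least 2 there is a second fibre; an element of it
        is missing from part \<open>t\<close>, which is therefore strictly smaller than the whole
        structure.\<close>
      obtain l where l: "l < m0" "l \<noteq> t"
        using d(2)[OF i] by (metis One_nat_def Suc_1 Suc_le_lessD lessI order.strict_trans2 zero_less_Suc zero_neq_one)
      then have "h i l \<noteq> h i t" using d(4)[OF i] True by (auto dest: inj_onD)
      moreover obtain x where "x \<in> base (S i) - {p i}" "b i x = h i l"
        using d(3)[OF i] l by (metis imageE imageI lessThan_iff)
      ultimately have "insert (p i) ?B \<subset> base (S i)" using pS by auto
      then have "base (S i) \<inter> insert (p i) ?B \<subset> base (S i)" by blast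
      from psubset_card_mono[OF fin this]
      have "card (base (fst (part t i))) < card (base (fst (s i)))"
        by (simp add: part_def S_def)
      moreover have "pointed_embeds k (part t i) (s i)"
        using pointed_embeds_restrict_to[of k "S i" _ "p i"] by (simp add: part_def S_def p_def)
      moreover have "part t i \<in> pointed_bounded k n"
        unfolding part_def by (rule pointed_bounded_restrict_to[OF s])
      ultimately show "part t i \<in> {x \<in> pointed_bounded k n.
          \<exists>i. pointed_embeds k x (s i) \<and> card (base (fst x)) < card (base (fst (s i)))}" by blast
    qed
    moreover have "\<not> bad_seq (pointed_embeds k)
      {x \<in> pointed_bounded k n. \<exists>i. pointed_embeds k x (s i) \<and> card (base (fst x)) < card (base (fst (s i)))}
      (part t \<circ> enumerate Y)"
      by (rule no_bad_seq_of_parts[where \<mu> = "\<lambda>X. card (base (fst X))", OF _ bad])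
        (erule (1) pointed_embeds_trans, erule (1) minimal)
    ultimately show False by contradiction
  next
    case False
    then have "colour {i, j} = m0" using t[of i j] colour_le[of "{i, j}"] ij by simp
    then have parts: "pointed_embeds k (part l i) (part l j)" if "l < m0" for l
      using not_less_Least[of l "\<lambda>l. l = m0 \<or> \<not> pointed_embeds k (part l i) (part l j)"] that ij
      by (simp add: colour_def)
    have J': "i \<in> J" "j \<in> J" using ij Y by auto
    have "pointed_embeds k (S i, p i) (S j, p j)"
    proof (rule pointed_embeds_glue)
      show "0 < m0" using d(2)[OF J'(1)] by simp
      show "diagram k (S i) m0 (h i) = diagram k (S j) m0 (h j)" using m0 J' by simp
      show "pointed_embeds k
          (restrict_to (S i) (insert (p i) {x \<in> base (S i) - {p i}. b i x = h i l}), p i)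
          (restrict_to (S j) (insert (p j) {x \<in> base (S j) - {p j}. b j x = h j l}), p j)"
        if "l < m0" for l
        using parts[OF that] by (simp only: part_def)
    qed (rule d J' pS)+
    with notle ij show False by blast
  qed
qed

section \<open>Ages\<close>

text \<open>Taking copies over the natural numbers makes the pointed ages of all structures
  comparable, as subsets of one countable set.\<close>

definition pointed_age :: "nat \<Rightarrow> 'a bstruct \<Rightarrow> 'a \<Rightarrow> (nat bstruct \<times> nat) set" where
  "pointed_age k R x = {(T, p). is_bstruct k T \<and> finite (base T) \<and> p \<in> base T \<and>
     pointed_embeds k (T, p) (R, x)}"

text \<open>Relations outside \<open>{1..k}\<close> are empty, so a finite structure is coded
  faithfully by its base and one finite set of triples.\<close>

lemma countable_finite_bstructs: "countable {T :: nat bstruct. is_bstruct k T \<and> finite (base T)}"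
proof -
  let ?code = "\<lambda>T :: nat bstruct. (base T, Sigma {1..k} (rel T))"
  let ?F = "{T :: nat bstruct. is_bstruct k T \<and> finite (base T)}"
  have "inj_on ?code ?F"
  proof (rule inj_onI)
    fix T U :: "nat bstruct"
    assume T: "T \<in> ?F" and U: "U \<in> ?F" and eq: "?code T = ?code U"
    have "rel T i = rel U i" for i
    proof (cases "i \<in> {1..k}")
      case True
      then have "rel V i = Sigma {1..k} (rel V) `` {i}" for V :: "nat bstruct" by auto
      with eq show ?thesis by simp
    next
      case False
      with T U show ?thesis by (simp add: is_bstruct_def)
    qed
    with eq show "T = U" by (cases T; cases U) auto
  qed
  moreover have "countable (?code ` ?F)"
  proof (rule countable_subset)
    show "?code ` ?F \<subseteq> Collect finite \<times> Collect finite"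
      by (auto simp: is_bstruct_def intro!: finite_SigmaI intro: finite_subset)
    show "countable (Collect finite \<times> Collect finite :: (nat set \<times> (nat \<times> nat \<times> nat) set) set)"
      by (intro countable_SIGMA countable_Collect_finite)
  qed
  ultimately show ?thesis by (rule countable_image_inj_on[rotated])
qed

lemma countable_pointed_bounded: "countable (pointed_bounded k n :: (nat bstruct \<times> nat) set)"
proof (rule countable_subset)
  show "pointed_bounded k n \<subseteq> {T :: nat bstruct. is_bstruct k T \<and> finite (base T)} \<times> (UNIV :: nat set)"
    by (auto simp: pointed_bounded_def)
qed (intro countable_SIGMA countable_finite_bstructs countableI_type)

text \<open>The pointed age determines the age: each finite subset of \<open>R\<close> can be
  enlarged by \<open>x\<close>, and the original subset is recovered by restricting.\<close>

lemma Age_eq_pointed_age: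
  assumes "x \<in> base R"
  shows "Age k R = (\<Union>(T, p) \<in> pointed_age k R x. {iso_type k (restrict_to T F) | F. F \<subseteq> base T})"
proof (intro equalityI subsetI)
  fix c
  assume "c \<in> Age k R"
  then obtain F where F: "F \<subseteq> base R" "finite F" and c: "c = iso_type k (restrict_to R F)"
    by (auto simp: Age_def)
  have xF: "insert x F \<subseteq> base R" "finite (insert x F)" using F assms by auto
  obtain T :: "nat bstruct" and g where T: "is_bstruct k T" "finite (base T)" "embedding k g T R"
    "g ` base T = insert x F"
    using obtain_nat_copy[OF xF] by metis
  obtain p where p: "p \<in> base T" "g p = x" using T(4) by (metis image_iff insertI1)
  \<comment> \<open>Pulling \<open>F\<close> back discards the added point again unless
    \<open>x\<close> was in \<open>F\<close> from the start.\<close>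
  let ?G = "{a \<in> base T. g a \<in> F}"
  have "g ` ?G = F" using T(4) by auto
  then have "c = iso_type k (restrict_to T ?G)"
    using iso_type_eqI[OF isomorphic_restrict_to_image[OF T(3), of ?G]] c by simp
  moreover have "(T, p) \<in> pointed_age k R x"
    using T p by (auto simp: pointed_age_def pointed_embeds_def)
  ultimately show "c \<in> (\<Union>(T, p) \<in> pointed_age k R x. {iso_type k (restrict_to T F) | F. F \<subseteq> base T})"
    by blast
next
  fix c
  assume "c \<in> (\<Union>(T, p) \<in> pointed_age k R x. {iso_type k (restrict_to T F) | F. F \<subseteq> base T})"
  then obtain T :: "nat bstruct" and f F where
    T: "finite (base T)" "embedding k f T R" "F \<subseteq> base T"
    and c: "c = iso_type k (restrict_to T F)"
    by (auto simp: pointed_age_def pointed_embeds_def)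
  have "c = iso_type k (restrict_to R (f ` F))"
    using iso_type_eqI[OF isomorphic_restrict_to_image[OF T(2,3)]] c by simp
  moreover have "f ` F \<subseteq> base R" using T(2,3) unfolding embedding_def by blast
  moreover have "finite (f ` F)" using finite_subset[OF T(3,1)] by simp
  ultimately show "c \<in> Age k R" unfolding Age_def by blast
qed

text \<open>This makes ind-minimality applicable to the age that remains after a kernel point is
  removed.\<close>

lemma hereditary_Age:
  fixes R :: "'a bstruct"
  shows "hereditary k (Age k R)"
  unfolding hereditary_def
proof (intro conjI subsetI ballI allI impI)
  fix c
  assume "c \<in> Age k R"
  then obtain F where F: "F \<subseteq> base R" "finite F" and c: "c = iso_type k (restrict_to R F)"
    by (auto simp: Age_def)
  obtain T :: "nat bstruct" and g where T: "is_bstruct k T" "finite (base T)" "embedding k g T R"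
    "g ` base T = F"
    using obtain_nat_copy[OF F] by metis
  then have "iso_type k T = c"
    using iso_type_eqI[OF isomorphic_restrict_to_range[OF T(3)]] c by simp
  with T show "c \<in> Omega k" by (auto simp: Omega_def)
next
  fix c T F
  assume "c \<in> Age k R" and T: "T \<in> c" and F: "F \<subseteq> base T"
  then obtain G where G: "G \<subseteq> base R" "finite G" and c: "c = iso_type k (restrict_to R G)"
    by (auto simp: Age_def)
  have "isomorphic k T (restrict_to R G)" "finite (base T)"
    using T c by (auto simp: iso_type_def intro: isomorphic_sym)
  then obtain g where g: "embedding k g T (restrict_to R G)"
    by (auto simp: isomorphic_iff_embedding)
  have "iso_type k (restrict_to T F) = iso_type k (restrict_to R (g ` F))"
    by (rule iso_type_eqI[OF isomorphic_restrict_to_image[OF embedding_restrict_toD[OF g] F]])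
  moreover have "g ` F \<subseteq> base R"
    using embedding_restrict_toD[OF g] F unfolding embedding_def by blast
  moreover have "finite (g ` F)" using finite_subset[OF F \<open>finite (base T)\<close>] by simp
  ultimately show "iso_type k (restrict_to T F) \<in> Age k R" unfolding Age_def by blast
qed

text \<open>Finitely many isomorphism types have finitely many sizes, and every finite
  indecomposable restriction of \<open>R\<close> realises one of these types.\<close>

lemma indecomposables_bounded:
  fixes R :: "'a bstruct"
  assumes fin: "finite (Age k R \<inter> Ind_Omega k)"
  shows "\<exists>n. \<forall>F \<subseteq> base R. finite F \<longrightarrow> indecomposable k (restrict_to R F) \<longrightarrow> card F \<le> n"
proof -
  \<comment> \<open>An arbitrary member may be chosen, because all members of an isomorphism type
    have the same number of elements.\<close>
  let ?size = "\<lambda>c :: nat bstruct set. card (base (SOME T. T \<in> c))"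
  have "card F \<le> Max (?size ` (Age k R \<inter> Ind_Omega k))"
    if F: "F \<subseteq> base R" "finite F" and ind: "indecomposable k (restrict_to R F)" for F
  proof -
    let ?c = "iso_type k (restrict_to R F)"
    obtain T :: "nat bstruct" and g where T: "is_bstruct k T" "finite (base T)" "embedding k g T R"
      "g ` base T = F"
      using obtain_nat_copy[OF F] by metis
    have iso: "isomorphic k T (restrict_to R F)"
      using isomorphic_restrict_to_range[OF T(3)] T(4) by simp
    have "indecomposable k T" by (rule indecomposable_isomorphic[OF iso ind])
    then have "?c \<in> Ind_Omega k"
      using T iso_type_eqI[OF iso] by (auto simp: Ind_Omega_def)
    moreover have "?c \<in> Age k R" using F unfolding Age_def by blast
    moreover have "?size ?c = card F"
    proof -
      have "T \<in> ?c" using T iso by (auto simp: iso_type_def intro: isomorphic_sym)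
      then have "(SOME T. T \<in> ?c) \<in> ?c" by (rule someI)
      then have "isomorphic k (restrict_to R F) (SOME T. T \<in> ?c)" by (simp add: iso_type_def)
      then show ?thesis
        using F bij_betw_same_card by (fastforce simp: isomorphic_def Int_absorb1)
    qed
    ultimately have "card F \<in> ?size ` (Age k R \<inter> Ind_Omega k)"
      by (intro image_eqI[of _ _ ?c]) auto
    then show ?thesis using fin by (intro Max_ge finite_imageI)
  qed
  then show ?thesis by blast
qed

text \<open>Embeddings that send \<open>p\<close> to \<open>x\<close> carry sets avoiding
  \<open>p\<close> to sets of the same size avoiding \<open>x\<close>, so the bound \<open>n\<close>
  transfers. With closure under embeddings, the pointed age has the form counted by
  \<open>countable_downsets\<close>.\<close>

lemma pointed_age_downset:
  assumes "\<forall>F \<subseteq> base R - {x}. finite F \<longrightarrow> indecomposable k (restrict_to R F) \<longrightarrow> card F \<le> n"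
  shows "pointed_age k R x \<subseteq> pointed_bounded k n"
    and "\<forall>X\<in>pointed_age k R x. \<forall>Y\<in>pointed_bounded k n. pointed_embeds k Y X \<longrightarrow> Y \<in> pointed_age k R x"
proof -
  show "pointed_age k R x \<subseteq> pointed_bounded k n"
  proof clarify
    fix T p
    assume "(T, p) \<in> pointed_age k R x"
    then obtain f where T: "is_bstruct k T" "finite (base T)" "p \<in> base T" and f: "embedding k f T R" "f p = x"
      by (auto simp: pointed_age_def pointed_embeds_def)
    have "card F \<le> n" if F: "F \<subseteq> base T - {p}" and ind: "indecomposable k (restrict_to T F)" for F
    proof -
      have inj: "inj_on f (base T)" and sub: "f ` base T \<subseteq> base R" using f by (auto simp: embedding_def)
      have "isomorphic k (restrict_to T F) (restrict_to R (f ` F))"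
        using isomorphic_restrict_to_image[OF f(1)] F by blast
      then have "indecomposable k (restrict_to R (f ` F))"
        using ind indecomposable_isomorphic isomorphic_sym by metis
      moreover have "f ` F \<subseteq> base R - {x}"
        using F inj sub f(2) T(3) by (auto dest: inj_onD)
      moreover have "finite (f ` F)" using F T(2) by (meson Diff_subset finite_imageI finite_subset)
      moreover have "card (f ` F) = card F"
        using F inj by (intro card_image) (auto intro: inj_on_subset)
      ultimately show ?thesis using assms by metis
    qed
    with T show "(T, p) \<in> pointed_bounded k n" by (auto simp: pointed_bounded_def)
  qed
  show "\<forall>X\<in>pointed_age k R x. \<forall>Y\<in>pointed_bounded k n. pointed_embeds k Y X \<longrightarrow> Y \<in> pointed_age k R x"
    by (auto simp: pointed_age_def pointed_bounded_def intro: pointed_embeds_trans)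
qed

theorem theorem5p31:
  fixes k :: nat
  assumes "k \<ge> 1"
  shows "countable {A \<in> ages_with_nonempty_kernel k TYPE('a). ind_minimal k A}"
proof -
  \<comment> \<open>This map recovers an age from a pointed age, so it suffices to count the
    possible pointed ages.\<close>
  define age where
    "age D = (\<Union>(T, p) \<in> D. {iso_type k (restrict_to T F) | F. F \<subseteq> base T})"
    for D :: "(nat bstruct \<times> nat) set"
  define \<D> :: "nat \<Rightarrow> (nat bstruct \<times> nat) set set" where
    "\<D> n = {D. D \<subseteq> pointed_bounded k n \<and>
      (\<forall>X\<in>D. \<forall>Y\<in>pointed_bounded k n. pointed_embeds k Y X \<longrightarrow> Y \<in> D)}" for n
  have "A \<in> age ` (\<Union>n. \<D> n)" if "A \<in> ages_with_nonempty_kernel k TYPE('a)" and min: "ind_minimal k A" for A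
  proof -
    obtain R :: "'a bstruct" and x where A: "A = Age k R" and x: "x \<in> Ker k R"
      using \<open>A \<in> ages_with_nonempty_kernel k TYPE('a)\<close> by (auto simp: ages_with_nonempty_kernel_def)
    have xR: "x \<in> base R" using x by (simp add: Ker_def)
    let ?R = "restrict_to R (base R - {x})"
    \<comment> \<open>Since \<open>x\<close> is in the kernel, the age of \<open>?R\<close> is a
      proper hereditary subclass of the ind-minimal class \<open>A\<close>.\<close>
    have "finite (Age k ?R \<inter> Ind_Omega k)"
      using x min hereditary_Age[of k ?R] by (simp add: A Ker_def ind_minimal_def)
    then obtain n where n: "\<forall>F \<subseteq> base ?R. finite F \<longrightarrow> indecomposable k (restrict_to ?R F) \<longrightarrow> card F \<le> n"
      using indecomposables_bounded by blast
    have "\<forall>F \<subseteq> base R - {x}. finite F \<longrightarrow> indecomposable k (restrict_to R F) \<longrightarrow> card F \<le> n"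
    proof (intro allI impI)
      fix F
      assume F: "F \<subseteq> base R - {x}" "finite F" "indecomposable k (restrict_to R F)"
      then have "(base R - {x}) \<inter> F = F" by blast
      with F n[rule_format, of F] show "card F \<le> n" by auto
    qed
    from pointed_age_downset[OF this] have "pointed_age k R x \<in> \<D> n"
      unfolding \<D>_def by (intro CollectI conjI)
    moreover have "A = age (pointed_age k R x)" unfolding A age_def by (rule Age_eq_pointed_age[OF xR])
    ultimately show ?thesis by blast
  qed
  then have "{A \<in> ages_with_nonempty_kernel k TYPE('a). ind_minimal k A} \<subseteq> age ` (\<Union>n. \<D> n)" by blast
  \<comment> \<open>The bound \<open>n\<close> depends on the age; a countable union over all bounds
    covers every case.\<close>
  moreover have "countable (\<D> n)" for n
    unfolding \<D>_def by (rule countable_downsets[OF countable_pointed_bounded pointed_bounded_wqo])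
  then have "countable (age ` (\<Union>n. \<D> n))" by (intro countable_image countable_UN) auto
  ultimately show ?thesis by (rule countable_subset)
qed

end
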